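(* Let $V$ be a module over a ring $\mathbb{K}$ and let $U\subset V$ be a non-empty subset. Put $$U^{[1]}:=\{(x,v,t)\in V\times V\times\mathbb{K}\mid x\in U,\ x+tv\in U\}.$$ Then the pair $(G_1,G_0)=(U^{[1]},U\times\mathbb{K})$ (morphism set $U^{[1]}$, object set $U\times \mathbb{K}$), with source, target and unit section $$\alpha(x,v,t):=(x,t),\qquad \beta(x,v,t):=(x+tv,t),\qquad 1_{(x,t)}:=(x,0,t),$$ and with product and inverse given (when $x'=x+tv$ and $t'=t$) by $$(x',v',t')\ast(x,v,t)=(x,v'+v,t),\qquad (x,v,t)^{-1}=(x+tv,-v,t),$$ is a groupoid (denoted $U^{\{1\}}$). Moreover, for each fixed $t\in\mathbb{K}$, the same formulae (with $t$ suppressed) define a groupoid $$U^{\{1\}}_t:=(U_t,U),\qquad U_t:=\{(x,v)\mid (x,v,t)\in U^{[1]}\},$$ with morphism set $U_t$ and object set $U$.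
   Context: Rings are unital; $\mathbb{K}$ is not assumed commutative. A groupoid $(G_1,G_0,\alpha,\beta,\ast,1,i)$ consists of a set $G_0$ of objects, a set $G_1$ of morphisms, source and target maps $\alpha,\beta:G_1\to G_0$, a product $a\ast b$ defined exactly when $\alpha(a)=\beta(b)$, with $\alpha(a\ast b)=\alpha(b)$, $\beta(a\ast b)=\beta(a)$, associative whenever defined, a unit section $1:G_0\to G_1$, $x\mapsto 1_x$, with $\alpha(1_x)=x=\beta(1_x)$, $a\ast 1_{\alpha(a)}=a$, $1_{\beta(b)}\ast b=b$, and an inversion $a\mapsto a^{-1}$ with $a\ast a^{-1}=1_{\beta(a)}$, $a^{-1}\ast a=1_{\alpha(a)}$. *)

theory Defs
  imports "HOL-Algebra.Module"
begin

text \<open>Both \<open>module\<close> locales of the distribution require commutative scalars. The locale below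
  is the unital left module over a possibly non-commutative ring, on the same record type as
  the \<open>module\<close> locale of HOL-Algebra. The zero ring is allowed.\<close>

locale left_module = R?: ring R + M?: abelian_group M
  for R :: "('r, 'p) ring_scheme" (structure)
  and M :: "('r, 'v, 'q) module_scheme" (structure) +
  assumes smult_closed:
      "\<lbrakk> t \<in> carrier R; v \<in> carrier M \<rbrakk> \<Longrightarrow> t \<odot>\<^bsub>M\<^esub> v \<in> carrier M"
    and smult_l_distr:
      "\<lbrakk> s \<in> carrier R; t \<in> carrier R; v \<in> carrier M \<rbrakk> \<Longrightarrow>
       (s \<oplus>\<^bsub>R\<^esub> t) \<odot>\<^bsub>M\<^esub> v = s \<odot>\<^bsub>M\<^esub> v \<oplus>\<^bsub>M\<^esub> t \<odot>\<^bsub>M\<^esub> v"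
    and smult_r_distr:
      "\<lbrakk> t \<in> carrier R; v \<in> carrier M; w \<in> carrier M \<rbrakk> \<Longrightarrow>
       t \<odot>\<^bsub>M\<^esub> (v \<oplus>\<^bsub>M\<^esub> w) = t \<odot>\<^bsub>M\<^esub> v \<oplus>\<^bsub>M\<^esub> t \<odot>\<^bsub>M\<^esub> w"
    and smult_assoc:
      "\<lbrakk> s \<in> carrier R; t \<in> carrier R; v \<in> carrier M \<rbrakk> \<Longrightarrow>
       (s \<otimes>\<^bsub>R\<^esub> t) \<odot>\<^bsub>M\<^esub> v = s \<odot>\<^bsub>M\<^esub> (t \<odot>\<^bsub>M\<^esub> v)"
    and smult_one: "v \<in> carrier M \<Longrightarrow> \<one>\<^bsub>R\<^esub> \<odot>\<^bsub>M\<^esub> v = v"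

lemma (in module) left_module: "left_module R M"
  by (intro left_module.intro left_module_axioms.intro)
     (auto simp: smult_l_distr smult_r_distr smult_assoc1
        intro: R.ring_axioms M.abelian_group_axioms)

text \<open>The product is partial: \<open>prd G a b\<close> is \<open>a * b\<close>, with value \<open>None\<close> where it is not defined.\<close>

record ('m, 'o) gpd =
  morphs :: "'m set"
  objs :: "'o set"
  src :: "'m \<Rightarrow> 'o"
  tgt :: "'m \<Rightarrow> 'o"
  prd :: "'m \<Rightarrow> 'm \<Rightarrow> 'm option"
  unt :: "'o \<Rightarrow> 'm"
  invs :: "'m \<Rightarrow> 'm"

locale groupoid =
  fixes G :: "('m, 'o, 'z) gpd_scheme"
  assumes src_closed: "a \<in> morphs G \<Longrightarrow> src G a \<in> objs G"
    and tgt_closed: "a \<in> morphs G \<Longrightarrow> tgt G a \<in> objs G"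
    and prd_defined_iff:
      "\<lbrakk> a \<in> morphs G; b \<in> morphs G \<rbrakk> \<Longrightarrow> prd G a b \<noteq> None \<longleftrightarrow> src G a = tgt G b"
    and prd_closed:
      "\<lbrakk> a \<in> morphs G; b \<in> morphs G; prd G a b = Some c \<rbrakk> \<Longrightarrow> c \<in> morphs G"
    and src_prd:
      "\<lbrakk> a \<in> morphs G; b \<in> morphs G; prd G a b = Some c \<rbrakk> \<Longrightarrow> src G c = src G b"
    and tgt_prd:
      "\<lbrakk> a \<in> morphs G; b \<in> morphs G; prd G a b = Some c \<rbrakk> \<Longrightarrow> tgt G c = tgt G a"
    and prd_assoc:
      "\<lbrakk> a \<in> morphs G; b \<in> morphs G; c \<in> morphs G; prd G a b = Some d; prd G b c = Some e \<rbrakk>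
       \<Longrightarrow> prd G d c = prd G a e"
    and unt_closed: "x \<in> objs G \<Longrightarrow> unt G x \<in> morphs G"
    and src_unt: "x \<in> objs G \<Longrightarrow> src G (unt G x) = x"
    and tgt_unt: "x \<in> objs G \<Longrightarrow> tgt G (unt G x) = x"
    and prd_unt_right: "a \<in> morphs G \<Longrightarrow> prd G a (unt G (src G a)) = Some a"
    and prd_unt_left: "b \<in> morphs G \<Longrightarrow> prd G (unt G (tgt G b)) b = Some b"
    and invs_closed: "a \<in> morphs G \<Longrightarrow> invs G a \<in> morphs G"
    and prd_invs_right: "a \<in> morphs G \<Longrightarrow> prd G a (invs G a) = Some (unt G (tgt G a))"
    and prd_invs_left: "a \<in> morphs G \<Longrightarrow> prd G (invs G a) a = Some (unt G (src G a))"

definition first_ext ::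
    "('r, 'p) ring_scheme \<Rightarrow> ('r, 'v, 'q) module_scheme \<Rightarrow> 'v set \<Rightarrow> ('v \<times> 'v \<times> 'r) set"
  where "first_ext K V U =
    {(x, v, t). (x, v, t) \<in> carrier V \<times> carrier V \<times> carrier K \<and>
                x \<in> U \<and> x \<oplus>\<^bsub>V\<^esub> t \<odot>\<^bsub>V\<^esub> v \<in> U}"

definition first_ext_at ::
    "('r, 'p) ring_scheme \<Rightarrow> ('r, 'v, 'q) module_scheme \<Rightarrow> 'v set \<Rightarrow> 'r \<Rightarrow> ('v \<times> 'v) set"
  where "first_ext_at K V U t = {(x, v). (x, v, t) \<in> first_ext K V U}"

definition ext_groupoid ::
    "('r, 'p) ring_scheme \<Rightarrow> ('r, 'v, 'q) module_scheme \<Rightarrow> 'v set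
      \<Rightarrow> ('v \<times> 'v \<times> 'r, 'v \<times> 'r) gpd"
  where "ext_groupoid K V U =
    \<lparr> morphs = first_ext K V U,
      objs = U \<times> carrier K,
      src = (\<lambda>(x, v, t). (x, t)),
      tgt = (\<lambda>(x, v, t). (x \<oplus>\<^bsub>V\<^esub> t \<odot>\<^bsub>V\<^esub> v, t)),
      prd = (\<lambda>(x', v', t') (x, v, t).
        if x' = x \<oplus>\<^bsub>V\<^esub> t \<odot>\<^bsub>V\<^esub> v \<and> t' = t then Some (x, v' \<oplus>\<^bsub>V\<^esub> v, t) else None),
      unt = (\<lambda>(x, t). (x, \<zero>\<^bsub>V\<^esub>, t)),
      invs = (\<lambda>(x, v, t). (x \<oplus>\<^bsub>V\<^esub> t \<odot>\<^bsub>V\<^esub> v, \<ominus>\<^bsub>V\<^esub> v, t)) \<rparr>"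

definition ext_groupoid_at ::
    "('r, 'p) ring_scheme \<Rightarrow> ('r, 'v, 'q) module_scheme \<Rightarrow> 'v set \<Rightarrow> 'r \<Rightarrow> ('v \<times> 'v, 'v) gpd"
  where "ext_groupoid_at K V U t =
    \<lparr> morphs = first_ext_at K V U t,
      objs = U,
      src = (\<lambda>(x, v). x),
      tgt = (\<lambda>(x, v). x \<oplus>\<^bsub>V\<^esub> t \<odot>\<^bsub>V\<^esub> v),
      prd = (\<lambda>(x', v') (x, v).
        if x' = x \<oplus>\<^bsub>V\<^esub> t \<odot>\<^bsub>V\<^esub> v then Some (x, v' \<oplus>\<^bsub>V\<^esub> v) else None),
      unt = (\<lambda>x. (x, \<zero>\<^bsub>V\<^esub>)),
      invs = (\<lambda>(x, v). (x \<oplus>\<^bsub>V\<^esub> t \<odot>\<^bsub>V\<^esub> v, \<ominus>\<^bsub>V\<^esub> v)) \<rparr>"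

end

theory Submission
  imports Defs
begin

text \<open>Fix a scalar \<open>t\<close>. Since \<open>v \<mapsto> t \<odot> v\<close> is additive, the additive group of \<open>V\<close> acts on the set
  \<open>V\<close> by letting \<open>v\<close> send \<open>x\<close> to \<open>x \<oplus> t \<odot> v\<close> (lemmas \<open>shift_zero\<close>, \<open>shift_add\<close>,
  \<open>smult_r_neg\<close>). A pair \<open>(x, v)\<close>, read as an arrow from \<open>x\<close> to its shift by \<open>v\<close>, is a morphism of
  the action groupoid, and requiring both endpoints to lie in \<open>U\<close> cuts out the full subgroupoid on
  the objects \<open>U\<close>. The groupoid laws in the second component are those of the group \<open>V\<close>; the laws of
  an action say that composites, units and inverses have the right endpoints, and membership in the
  morphism set is a condition on endpoints only.

  No arrow of \<open>ext_groupoid\<close> changes the scalar, so that groupoid is the disjoint union over \<open>t\<close> of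
  the groupoids just described, and its laws hold because they hold in each of them.\<close>

context left_module
begin

lemma smult_r_zero:
  assumes "t \<in> carrier R"
  shows "t \<odot>\<^bsub>M\<^esub> \<zero>\<^bsub>M\<^esub> = \<zero>\<^bsub>M\<^esub>"
proof -
  have "t \<odot>\<^bsub>M\<^esub> \<zero>\<^bsub>M\<^esub> \<oplus>\<^bsub>M\<^esub> t \<odot>\<^bsub>M\<^esub> \<zero>\<^bsub>M\<^esub> = t \<odot>\<^bsub>M\<^esub> \<zero>\<^bsub>M\<^esub>"
    using smult_r_distr[OF assms M.zero_closed M.zero_closed] by simp
  then show ?thesis
    using smult_closed[OF assms M.zero_closed] by (simp add: M.add.l_cancel_one)
qed

lemma shift_zero:
  assumes "t \<in> carrier R" "x \<in> carrier M"
  shows "x \<oplus>\<^bsub>M\<^esub> t \<odot>\<^bsub>M\<^esub> \<zero>\<^bsub>M\<^esub> = x"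
  using assms by (simp add: smult_r_zero)

lemma shift_add:
  assumes "t \<in> carrier R" "x \<in> carrier M" "v \<in> carrier M" "w \<in> carrier M"
  shows "x \<oplus>\<^bsub>M\<^esub> t \<odot>\<^bsub>M\<^esub> (w \<oplus>\<^bsub>M\<^esub> v) = (x \<oplus>\<^bsub>M\<^esub> t \<odot>\<^bsub>M\<^esub> v) \<oplus>\<^bsub>M\<^esub> t \<odot>\<^bsub>M\<^esub> w"
  using assms by (simp add: smult_r_distr smult_closed M.a_ac)

text \<open>The inverse law of the action, in the form that remains once sums are bracketed to the
  right: shifting by \<open>v\<close> and then by \<open>\<ominus> v\<close> returns to the start.\<close>

lemma smult_r_neg:
  assumes "t \<in> carrier R" "v \<in> carrier M"
  shows "t \<odot>\<^bsub>M\<^esub> v \<oplus>\<^bsub>M\<^esub> t \<odot>\<^bsub>M\<^esub> (\<ominus>\<^bsub>M\<^esub> v) = \<zero>\<^bsub>M\<^esub>"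
  using smult_r_distr[OF assms M.a_inv_closed[OF assms(2)]] assms
  by (simp add: M.r_neg smult_r_zero)

lemma groupoid_ext_groupoid_at:
  assumes t: "t \<in> carrier R" and U: "U \<subseteq> carrier M"
  shows "groupoid (ext_groupoid_at R M U t)"
proof -
  have UD: "x \<in> carrier M" if "x \<in> U" for x
    using U that by blast
  show ?thesis
    by unfold_locales
       (auto simp: ext_groupoid_at_def first_ext_at_def first_ext_def UD t smult_closed
          shift_zero shift_add smult_r_neg M.a_assoc M.l_neg M.r_neg split: if_splits)
qed

end

text \<open>The product is defined only within a fibre over a scalar \<open>t\<close>, and no structure map changes
  \<open>t\<close>. So each groupoid law about a single morphism or about a defined product stays over one
  \<open>t\<close>, where it is the law of the fibre with \<open>t\<close> carried along. Across fibres there is only the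
  question when a product is defined, and the condition in \<open>prd\<close> is equality of source and target
  outright.\<close>

lemma groupoid_ext_groupoid_if_fibres:
  assumes fibres: "\<And>t. t \<in> carrier K \<Longrightarrow> groupoid (ext_groupoid_at K V U t)"
  shows "groupoid (ext_groupoid K V U)"
proof -
  note defs = ext_groupoid_def ext_groupoid_at_def first_ext_at_def
  have scalar: "t \<in> carrier K" if "(x, v, t) \<in> first_ext K V U" for x v t
    using that by (simp add: first_ext_def)
  show ?thesis
  proof
    fix a assume a: "a \<in> morphs (ext_groupoid K V U)"
    obtain x v t where [simp]: "a = (x, v, t)" by (cases a)
    have t: "t \<in> carrier K" and a': "(x, v) \<in> morphs (ext_groupoid_at K V U t)"
      using a scalar by (auto simp: defs)
    interpret F: groupoid "ext_groupoid_at K V U t" by (rule fibres[OF t])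
    show "src (ext_groupoid K V U) a \<in> objs (ext_groupoid K V U)"
      using F.src_closed[OF a'] t by (simp add: defs)
    show "tgt (ext_groupoid K V U) a \<in> objs (ext_groupoid K V U)"
      using F.tgt_closed[OF a'] t by (simp add: defs)
    show "prd (ext_groupoid K V U) a (unt (ext_groupoid K V U) (src (ext_groupoid K V U) a)) = Some a"
      using F.prd_unt_right[OF a'] by (simp add: defs split: if_splits)
    show "prd (ext_groupoid K V U) (unt (ext_groupoid K V U) (tgt (ext_groupoid K V U) a)) a = Some a"
      using F.prd_unt_left[OF a'] by (simp add: defs split: if_splits)
    show "invs (ext_groupoid K V U) a \<in> morphs (ext_groupoid K V U)"
      using F.invs_closed[OF a'] by (simp add: defs)
    show "prd (ext_groupoid K V U) a (invs (ext_groupoid K V U) a)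
        = Some (unt (ext_groupoid K V U) (tgt (ext_groupoid K V U) a))"
      using F.prd_invs_right[OF a'] by (simp add: defs split: if_splits)
    show "prd (ext_groupoid K V U) (invs (ext_groupoid K V U) a) a
        = Some (unt (ext_groupoid K V U) (src (ext_groupoid K V U) a))"
      using F.prd_invs_left[OF a'] by (simp add: defs split: if_splits)
  next
    fix x assume x: "x \<in> objs (ext_groupoid K V U)"
    obtain y t where [simp]: "x = (y, t)" by (cases x)
    have t: "t \<in> carrier K" and x': "y \<in> objs (ext_groupoid_at K V U t)"
      using x by (auto simp: defs)
    interpret F: groupoid "ext_groupoid_at K V U t" by (rule fibres[OF t])
    show "unt (ext_groupoid K V U) x \<in> morphs (ext_groupoid K V U)"
      using F.unt_closed[OF x'] by (simp add: defs)
    show "src (ext_groupoid K V U) (unt (ext_groupoid K V U) x) = x"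
      by (simp add: defs)
    show "tgt (ext_groupoid K V U) (unt (ext_groupoid K V U) x) = x"
      using F.tgt_unt[OF x'] by (simp add: defs)
  next
    fix a b
    show "prd (ext_groupoid K V U) a b \<noteq> None
        \<longleftrightarrow> src (ext_groupoid K V U) a = tgt (ext_groupoid K V U) b"
      by (cases a; cases b) (simp add: defs)
  next
    fix a b c
    assume a: "a \<in> morphs (ext_groupoid K V U)" and b: "b \<in> morphs (ext_groupoid K V U)"
      and c: "prd (ext_groupoid K V U) a b = Some c"
    obtain x w y v t where [simp]: "a = (x, w, t)" "b = (y, v, t)" "c = (y, w \<oplus>\<^bsub>V\<^esub> v, t)"
      using c by (cases a; cases b) (auto simp: defs split: if_splits)
    have t: "t \<in> carrier K"
      and a': "(x, w) \<in> morphs (ext_groupoid_at K V U t)"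
      and b': "(y, v) \<in> morphs (ext_groupoid_at K V U t)"
      and c': "prd (ext_groupoid_at K V U t) (x, w) (y, v) = Some (y, w \<oplus>\<^bsub>V\<^esub> v)"
      using a b c scalar by (auto simp: defs split: if_splits)
    interpret F: groupoid "ext_groupoid_at K V U t" by (rule fibres[OF t])
    show "c \<in> morphs (ext_groupoid K V U)"
      using F.prd_closed[OF a' b' c'] by (simp add: defs)
    show "src (ext_groupoid K V U) c = src (ext_groupoid K V U) b"
      by (simp add: defs)
    show "tgt (ext_groupoid K V U) c = tgt (ext_groupoid K V U) a"
      using F.tgt_prd[OF a' b' c'] by (simp add: defs)
  next
    fix a b c d e
    assume abc: "a \<in> morphs (ext_groupoid K V U)" "b \<in> morphs (ext_groupoid K V U)"
        "c \<in> morphs (ext_groupoid K V U)"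
      and d: "prd (ext_groupoid K V U) a b = Some d"
      and e: "prd (ext_groupoid K V U) b c = Some e"
    obtain x u y v z w t where [simp]: "a = (x, u, t)" "b = (y, v, t)" "c = (z, w, t)"
      and [simp]: "d = (y, u \<oplus>\<^bsub>V\<^esub> v, t)" "e = (z, v \<oplus>\<^bsub>V\<^esub> w, t)"
      using d e by (cases a; cases b; cases c) (auto simp: defs split: if_splits)
    have t: "t \<in> carrier K"
      and a': "(x, u) \<in> morphs (ext_groupoid_at K V U t)"
      and b': "(y, v) \<in> morphs (ext_groupoid_at K V U t)"
      and c': "(z, w) \<in> morphs (ext_groupoid_at K V U t)"
      and d': "prd (ext_groupoid_at K V U t) (x, u) (y, v) = Some (y, u \<oplus>\<^bsub>V\<^esub> v)"
      and e': "prd (ext_groupoid_at K V U t) (y, v) (z, w) = Some (z, v \<oplus>\<^bsub>V\<^esub> w)"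
      using abc d e scalar by (auto simp: defs split: if_splits)
    interpret F: groupoid "ext_groupoid_at K V U t" by (rule fibres[OF t])
    show "prd (ext_groupoid K V U) d c = prd (ext_groupoid K V U) a e"
      using F.prd_assoc[OF a' b' c' d' e'] by (simp add: defs split: if_splits)
  qed
qed

theorem theorem2p4:
  fixes K :: "('r, 'p) ring_scheme"
    and V :: "('r, 'v, 'q) module_scheme"
    and U :: "'v set"
  assumes "left_module K V"
    and "U \<subseteq> carrier V"
    and "U \<noteq> {}"
  shows "groupoid (ext_groupoid K V U) \<and>
         (\<forall>t \<in> carrier K. groupoid (ext_groupoid_at K V U t))"
  using left_module.groupoid_ext_groupoid_at[OF assms(1) _ assms(2)]
    groupoid_ext_groupoid_if_fibres by blast

end
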